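(* Let $H$ be a complex Hilbert space, let $R_0$ be a trace-class positive operator on $H$, and let $(u_n)_{n\ge 0}$ be a sequence of unit vectors in $H$. Define $R_{n+1}=R_n^{1/2}(I-|u_n\rangle\langle u_n|)R_n^{1/2}$ for $n\ge 0$, and let $R_\infty$ be the strong operator limit of $(R_n)$. If $(u_n)_{n\ge 0}$ is dense in the unit sphere of $H$, then $R_\infty=0$.
   Context: Inner products are linear in the second variable. $|a\rangle\langle b|$ denotes the operator $x\mapsto\langle b,x\rangle a$. Each $R_n$ is a bounded positive operator, and the sequence $(R_n)$ is decreasing in the Löwner order and bounded below by $0$, so it converges in the strong operator topology to some bounded positive operator $R_\infty$ (if some $R_n=0$, then $R_k=0$ for all $k\ge n$). *)

theory Defs
  imports "HOL-Analysis.Analysis"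
begin

section \<open>Complex Hilbert spaces\<close>

text \<open>
  The norm and the real scalar multiplication come from the class \<^class>\<open>banach\<close>; the axioms tie
  them to the complex structure. The inner product is linear in the second variable.
\<close>

class chilbert_space = banach +
  fixes scaleC :: "complex \<Rightarrow> 'a \<Rightarrow> 'a"  (infixr \<open>*\<^sub>C\<close> 75)
    and cinner :: "'a \<Rightarrow> 'a \<Rightarrow> complex"
  assumes scaleC_add_right: "c *\<^sub>C (x + y) = c *\<^sub>C x + c *\<^sub>C y"
    and scaleC_add_left: "(c + d) *\<^sub>C x = c *\<^sub>C x + d *\<^sub>C x"
    and scaleC_scaleC: "c *\<^sub>C (d *\<^sub>C x) = (c * d) *\<^sub>C x"
    and scaleC_one: "1 *\<^sub>C x = x"
    and scaleR_scaleC: "r *\<^sub>R x = complex_of_real r *\<^sub>C x"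
    and cinner_commute: "cinner x y = cnj (cinner y x)"
    and cinner_add_right: "cinner x (y + z) = cinner x y + cinner x z"
    and cinner_scaleC_right: "cinner x (c *\<^sub>C y) = c * cinner x y"
    and cinner_ge_zero: "0 \<le> Re (cinner x x)"
    and cinner_eq_zero_iff: "cinner x x = 0 \<longleftrightarrow> x = 0"
    and norm_eq_sqrt_cinner: "norm x = sqrt (Re (cinner x x))"

lemma vector_space_scaleC: "vector_space (scaleC :: complex \<Rightarrow> 'a::chilbert_space \<Rightarrow> 'a)"
  by unfold_locales (rule scaleC_add_right scaleC_add_left scaleC_scaleC scaleC_one)+

lemma cinner_self: "cinner x x = complex_of_real ((norm x)\<^sup>2)" for x :: "'a::chilbert_space"
proof -
  have "Im (cinner x x) = 0"
    using arg_cong[OF cinner_commute[of x x], of Im] by simp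
  then show ?thesis
    by (simp add: norm_eq_sqrt_cinner cinner_ge_zero complex_eq_iff)
qed

lemma cinner_add_left: "cinner (x + y) z = cinner x z + cinner y z" for x :: "'a::chilbert_space"
  by (metis cinner_add_right cinner_commute complex_cnj_add)

lemma cinner_scaleC_left: "cinner (c *\<^sub>C x) y = cnj c * cinner x y" for x :: "'a::chilbert_space"
  by (metis cinner_scaleC_right cinner_commute complex_cnj_mult)

lemma norm_scaleC: "norm (c *\<^sub>C x) = cmod c * norm x" for x :: "'a::chilbert_space"
proof -
  have "complex_of_real ((norm (c *\<^sub>C x))\<^sup>2) = (c * cnj c) * complex_of_real ((norm x)\<^sup>2)"
    by (simp only: cinner_self[symmetric] cinner_scaleC_left cinner_scaleC_right mult_ac)
  also have "\<dots> = complex_of_real ((cmod c * norm x)\<^sup>2)"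
    by (simp only: complex_norm_square power_mult_distrib of_real_mult)
  finally have "(norm (c *\<^sub>C x))\<^sup>2 = (cmod c * norm x)\<^sup>2"
    by (simp only: of_real_eq_iff)
  then show ?thesis
    by (simp add: power2_eq_iff_nonneg)
qed

lemma cinner_Cauchy_Schwarz: "cmod (cinner x y) \<le> norm x * norm y" for x y :: "'a::chilbert_space"
proof (cases "x = 0")
  case True
  have "cinner (0 + 0) y = cinner 0 y + cinner 0 y"
    by (rule cinner_add_left)
  then show ?thesis using True by simp
next
  case False
  define a where "a = cinner x y"
  define z where "z = complex_of_real ((norm x)\<^sup>2) *\<^sub>C y + (- a) *\<^sub>C x"
  have yx: "cinner y x = cnj a"
    by (metis a_def cinner_commute)
  let ?r = "complex_of_real ((norm x)\<^sup>2)"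
  have "cinner z z = ?r * (?r * cinner y y) - ?r * (a * cnj a)"
    unfolding z_def cinner_add_left cinner_add_right cinner_scaleC_left cinner_scaleC_right
      yx a_def[symmetric] cinner_self[of x]
    by (simp add: algebra_simps)
  then have "cinner z z = complex_of_real ((norm x)\<^sup>2 * ((norm x)\<^sup>2 * (norm y)\<^sup>2 - (cmod a)\<^sup>2))"
    by (simp only: cinner_self[of y] complex_norm_square[symmetric] of_real_mult of_real_diff
        right_diff_distrib)
  moreover have "0 \<le> Re (cinner z z)" by (rule cinner_ge_zero)
  ultimately have "0 \<le> (norm x)\<^sup>2 * ((norm x)\<^sup>2 * (norm y)\<^sup>2 - (cmod a)\<^sup>2)"
    by (simp only: Re_complex_of_real)
  then have "(cmod a)\<^sup>2 \<le> (norm x * norm y)\<^sup>2"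
    using False by (simp add: zero_le_mult_iff power_mult_distrib)
  then show ?thesis
    unfolding a_def by (rule power2_le_imp_le) simp
qed

definition is_onb :: "'a::chilbert_space set \<Rightarrow> bool" where
  "is_onb B \<longleftrightarrow> (\<forall>e\<in>B. \<forall>f\<in>B. cinner e f = (if e = f then 1 else 0)) \<and>
     closure (module.span scaleC B) = UNIV"


section \<open>Bounded operators\<close>

text \<open>
  The type \<open>'a \<Rightarrow>\<^sub>L 'a\<close> consists of the bounded real-linear maps, so complex linearity is
  a separate predicate.
\<close>

definition clinear :: "('a::chilbert_space \<Rightarrow>\<^sub>L 'a) \<Rightarrow> bool" where
  "clinear A \<longleftrightarrow> Vector_Spaces.linear scaleC scaleC (blinfun_apply A)"

definition positive_op :: "('a::chilbert_space \<Rightarrow>\<^sub>L 'a) \<Rightarrow> bool" where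
  "positive_op A \<longleftrightarrow> clinear A \<and> (\<forall>x. cinner x (A x) \<in> \<real>\<^sub>\<ge>\<^sub>0)"

text \<open>
  The adjoint and the positive square root are unique; the definite descriptions below are
  meaningful for complex-linear and for positive operators, respectively.
\<close>

definition adj_op :: "('a::chilbert_space \<Rightarrow>\<^sub>L 'a) \<Rightarrow> ('a \<Rightarrow>\<^sub>L 'a)" where
  "adj_op A = (THE B. \<forall>x y. cinner (blinfun_apply B x) y = cinner x (A y))"

definition sqrt_op :: "('a::chilbert_space \<Rightarrow>\<^sub>L 'a) \<Rightarrow> ('a \<Rightarrow>\<^sub>L 'a)" where
  "sqrt_op A = (THE B. positive_op B \<and> B o\<^sub>L B = A)"

definition abs_op :: "('a::chilbert_space \<Rightarrow>\<^sub>L 'a) \<Rightarrow> ('a \<Rightarrow>\<^sub>L 'a)" where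
  "abs_op A = sqrt_op (adj_op A o\<^sub>L A)"

definition trace_class :: "('a::chilbert_space \<Rightarrow>\<^sub>L 'a) \<Rightarrow> bool" where
  "trace_class A \<longleftrightarrow> clinear A \<and>
     (\<exists>B. is_onb B \<and> (\<lambda>e. cinner e (abs_op A e)) summable_on B)"

definition ketbra :: "'a::chilbert_space \<Rightarrow> 'a \<Rightarrow> ('a \<Rightarrow>\<^sub>L 'a)" where
  "ketbra a b = Blinfun (\<lambda>x. cinner b x *\<^sub>C a)"

lemma ketbra_apply: "ketbra a b x = cinner b x *\<^sub>C a"
proof -
  have "bounded_linear (\<lambda>x. cinner b x *\<^sub>C a)"
  proof (rule bounded_linear_intro)
    show "cinner b (x + y) *\<^sub>C a = cinner b x *\<^sub>C a + cinner b y *\<^sub>C a" for x y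
      by (simp add: cinner_add_right scaleC_add_left)
    show "cinner b (r *\<^sub>R x) *\<^sub>C a = r *\<^sub>R (cinner b x *\<^sub>C a)" for r x
      by (simp add: scaleR_scaleC cinner_scaleC_right scaleC_scaleC)
    show "norm (cinner b x *\<^sub>C a) \<le> norm x * (norm b * norm a)" for x
      using mult_right_mono[OF cinner_Cauchy_Schwarz[of b x] norm_ge_zero[of a]]
      by (simp add: norm_scaleC mult_ac)
  qed
  then show ?thesis
    by (simp add: ketbra_def bounded_linear_Blinfun_apply)
qed


section \<open>The sequence of operators and its limit\<close>

primrec R_seq :: "('a::chilbert_space \<Rightarrow>\<^sub>L 'a) \<Rightarrow> (nat \<Rightarrow> 'a) \<Rightarrow> nat \<Rightarrow> ('a \<Rightarrow>\<^sub>L 'a)" where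
  "R_seq R0 u 0 = R0"
| "R_seq R0 u (Suc n) =
     sqrt_op (R_seq R0 u n) o\<^sub>L (id_blinfun - ketbra (u n) (u n)) o\<^sub>L sqrt_op (R_seq R0 u n)"

definition R_infty :: "('a::chilbert_space \<Rightarrow>\<^sub>L 'a) \<Rightarrow> (nat \<Rightarrow> 'a) \<Rightarrow> ('a \<Rightarrow>\<^sub>L 'a)" where
  "R_infty R0 u = (THE T. limitin strong_operator_topology (R_seq R0 u) T sequentially)"

end

theory Submission
  imports Defs
begin

text \<open>
  Write \<open>\<langle>x, A x\<rangle>\<close> for the quadratic form \<open>quad A x\<close> of \<open>A\<close>. The idea is that each step removes exactly
  \<open>\<langle>u n, R n (u n)\<rangle>\<close> from the trace. With \<open>S = (R n)\<^bsup>1/2\<^esup>\<close>, the form at \<open>x\<close> drops by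
  \<open>\<bar>\<langle>u n, S x\<rangle>\<bar>\<^sup>2 = \<bar>\<langle>S (u n), x\<rangle>\<bar>\<^sup>2\<close>; summed over an orthonormal basis this is, by Parseval,
  \<open>\<parallel>S (u n)\<parallel>\<^sup>2 = \<langle>u n, R n (u n)\<rangle>\<close>. As the traces stay nonnegative and start from a finite value, the
  series of the \<open>\<langle>u n, R n (u n)\<rangle>\<close> converges (lemma \<open>summable_quad_R_seq\<close>), so its terms tend to 0.

  For a unit vector \<open>x\<close> the numbers \<open>\<langle>x, R n x\<rangle>\<close> decrease. Suppose they stay above some
  \<open>\<epsilon> > 0\<close>. The seminorms \<open>\<parallel>(R n)\<^bsup>1/2\<^esup> y\<parallel>\<close> are equicontinuous in \<open>y\<close>, so \<open>\<langle>u n, R n (u n)\<rangle> \<ge> \<epsilon>/4\<close>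
  whenever \<open>u n\<close> is close to a multiple \<open>w x\<close> with \<open>\<bar>w\<bar> = 1\<close>. There are infinitely many such
  multiples, so by density this happens for arbitrarily large \<open>n\<close> (lemma
  \<open>dense_sequence_returns\<close>), a contradiction. Hence \<open>\<langle>x, R n x\<rangle> \<rightarrow> 0\<close>, and
  \<open>\<parallel>R n x\<parallel>\<^sup>2 \<le> M \<langle>x, R n x\<rangle>\<close> with a uniform \<open>M\<close> gives \<open>R n x \<rightarrow> 0\<close>. So 0 is the strong
  limit, and it is the only one.

  The definitions of the recursion and of the absolute value rest on the positive square root, whose
  existence and uniqueness are proved first (lemma \<open>ex1_sqrt\<close>).
\<close>

section \<open>Algebra of the inner product\<close>

lemma bounded_bilinear_cinner: "bounded_bilinear (cinner :: 'a::chilbert_space \<Rightarrow> 'a \<Rightarrow> complex)"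
proof
  show "cinner (a + a') b = cinner a b + cinner a' b" for a a' b :: 'a
    by (rule cinner_add_left)
  show "cinner a (b + b') = cinner a b + cinner a b'" for a b b' :: 'a
    by (rule cinner_add_right)
  show "cinner (r *\<^sub>R a) b = r *\<^sub>R cinner a b" for r and a b :: 'a
    by (simp add: scaleR_scaleC cinner_scaleC_left scaleR_conv_of_real)
  show "cinner a (r *\<^sub>R b) = r *\<^sub>R cinner a b" for r and a b :: 'a
    by (simp add: scaleR_scaleC cinner_scaleC_right scaleR_conv_of_real)
  show "\<exists>K. \<forall>a b :: 'a. norm (cinner a b) \<le> norm a * norm b * K"
    by (intro exI[of _ 1]) (simp add: cinner_Cauchy_Schwarz)
qed

interpretation cinner: bounded_bilinear "cinner :: 'a::chilbert_space \<Rightarrow> 'a \<Rightarrow> complex"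
  by (rule bounded_bilinear_cinner)

lemma cinner_cnj: "cnj (cinner x y) = cinner y x"
  by (metis cinner_commute)

lemma cinner_left_ext:
  assumes "\<And>y. cinner a y = cinner b y"
  shows "a = b"
proof -
  have "cinner (a - b) (a - b) = 0"
    using assms[of "a - b"] by (simp add: cinner.diff_left)
  then show ?thesis
    by (simp add: cinner_eq_zero_iff)
qed

lemma norm_diff_square:
  "(norm (x - y))\<^sup>2 = (norm x)\<^sup>2 - 2 * Re (cinner x y) + (norm y)\<^sup>2" for x y :: "'a::chilbert_space"
proof -
  have "complex_of_real ((norm (x - y))\<^sup>2) = cinner (x - y) (x - y)"
    by (rule cinner_self[symmetric])
  also have "\<dots> = cinner x x - (cinner x y + cnj (cinner x y)) + cinner y y"
    by (simp add: cinner.diff_left cinner.diff_right cinner_cnj)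
  also have "\<dots> = complex_of_real ((norm x)\<^sup>2 - 2 * Re (cinner x y) + (norm y)\<^sup>2)"
    by (simp add: cinner_self complex_add_cnj)
  finally show ?thesis
    by (simp only: of_real_eq_iff)
qed


section \<open>Hermitian and positive operators\<close>

definition hermitian :: "('a::chilbert_space \<Rightarrow>\<^sub>L 'a) \<Rightarrow> bool" where
  "hermitian A \<longleftrightarrow> (\<forall>x y. cinner x (A y) = cinner (A x) y)"

definition quad :: "('a::chilbert_space \<Rightarrow>\<^sub>L 'a) \<Rightarrow> 'a \<Rightarrow> real" where
  "quad A x = Re (cinner x (A x))"

lemma hermitianD: "hermitian A \<Longrightarrow> cinner x (A y) = cinner (A x) y"
  by (simp add: hermitian_def)

lemma clinear_iff: "clinear A \<longleftrightarrow> (\<forall>c x. A (c *\<^sub>C x) = c *\<^sub>C A x)"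
proof
  assume "clinear A"
  then interpret Vector_Spaces.linear scaleC scaleC "blinfun_apply A"
    by (simp add: clinear_def)
  show "\<forall>c x. A (c *\<^sub>C x) = c *\<^sub>C A x"
    by (simp add: scale)
next
  assume *: "\<forall>c x. A (c *\<^sub>C x) = c *\<^sub>C A x"
  then show "clinear A"
    by (simp add: clinear_def Vector_Spaces.linear_iff vector_space_scaleC blinfun.add_right)
qed

text \<open>
  The adjoint relation determines the values of \<open>A\<close>, so complex linearity follows from conjugate
  linearity in the first argument. In constructions below it is therefore enough to track
  \<open>hermitian\<close>.
\<close>

lemma hermitian_clinear:
  assumes "hermitian A"
  shows "clinear A"
  unfolding clinear_iff
proof (intro allI cinner_left_ext)
  fix c x y
  show "cinner (A (c *\<^sub>C x)) y = cinner (c *\<^sub>C A x) y"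
    by (simp add: hermitianD[OF assms, symmetric] cinner_scaleC_left)
qed

lemma hermitian_cinner_self: "hermitian A \<Longrightarrow> cinner x (A x) = complex_of_real (quad A x)"
  by (metis hermitianD cinner_cnj quad_def complex_is_Real_iff of_real_Re Reals_cnj_iff)

text \<open>
  Polarization: the defect \<open>f x y = \<langle>x, A y\<rangle> - \<langle>A x, y\<rangle>\<close> is sesquilinear and vanishes on the diagonal.
  Evaluating it at \<open>x + y\<close> and at \<open>x + \<i> y\<close> gives \<open>f x y + f y x = 0\<close> and \<open>f x y - f y x = 0\<close>.
\<close>

lemma positive_op_hermitian:
  assumes "positive_op A"
  shows "hermitian A"
proof -
  have lin: "A (c *\<^sub>C x) = c *\<^sub>C A x" for c x
    using assms by (simp add: positive_op_def clinear_iff)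
  define f where "f x y = cinner x (A y) - cinner (A x) y" for x y
  have f_self: "f x x = 0" for x
  proof -
    have "cinner x (A x) \<in> \<real>"
      using assms by (auto simp: positive_op_def complex_nonneg_Reals_iff complex_is_Real_iff)
    then have "cnj (cinner x (A x)) = cinner x (A x)"
      by (simp add: Reals_cnj_iff)
    then show ?thesis
      by (simp add: f_def cinner_cnj)
  qed
  have "f x y = 0" for x y
  proof -
    have "f (x + y) (x + y) = f x x + f x y + f y x + f y y"
      by (simp add: f_def blinfun.add_right cinner.add_left cinner.add_right)
    moreover have "f (x + \<i> *\<^sub>C y) (x + \<i> *\<^sub>C y) = f x x + \<i> * f x y - \<i> * f y x + f y y"
      by (simp add: f_def blinfun.add_right cinner.add_left cinner.add_right lin
          cinner_scaleC_left cinner_scaleC_right algebra_simps)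
    ultimately show ?thesis
      by (simp add: f_self algebra_simps add_eq_0_iff)
  qed
  then show ?thesis
    by (simp add: f_def hermitian_def)
qed

lemma positive_op_iff: "positive_op A \<longleftrightarrow> hermitian A \<and> (\<forall>x. 0 \<le> quad A x)"
proof
  assume "positive_op A"
  then show "hermitian A \<and> (\<forall>x. 0 \<le> quad A x)"
    using positive_op_hermitian
    by (auto simp: positive_op_def quad_def complex_nonneg_Reals_iff)
next
  assume *: "hermitian A \<and> (\<forall>x. 0 \<le> quad A x)"
  then show "positive_op A"
    by (simp add: positive_op_def hermitian_clinear hermitian_cinner_self)
qed

lemma quad_le_norm: "quad A x \<le> norm A * (norm x)\<^sup>2"
proof -
  have "quad A x \<le> norm x * norm (A x)"
    unfolding quad_def by (meson complex_Re_le_cmod cinner_Cauchy_Schwarz order_trans)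
  also have "\<dots> \<le> norm x * (norm A * norm x)"
    by (intro mult_left_mono norm_blinfun norm_ge_zero)
  finally show ?thesis
    by (simp add: power2_eq_square mult_ac)
qed

lemma quad_scaleC:
  assumes "clinear A"
  shows "quad A (c *\<^sub>C x) = (cmod c)\<^sup>2 * quad A x"
proof -
  have "cinner (c *\<^sub>C x) (A (c *\<^sub>C x)) = complex_of_real ((cmod c)\<^sup>2) * cinner x (A x)"
    using assms by (simp only: clinear_iff cinner_scaleC_left cinner_scaleC_right
        complex_norm_square mult_ac)
  then show ?thesis
    by (simp only: quad_def) simp
qed

lemma quad_square: "hermitian S \<Longrightarrow> quad (S o\<^sub>L S) x = (norm (S x))\<^sup>2"
  by (simp add: quad_def hermitianD cinner_self)

lemma positive_op_square: "hermitian S \<Longrightarrow> positive_op (S o\<^sub>L S)"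
  by (simp add: positive_op_iff quad_square) (simp add: hermitian_def)

text \<open>
  This estimate converts smallness of the quadratic form into smallness of \<open>A x\<close>. It comes from
  positivity of the form at the single vector \<open>M x - A x\<close>.
\<close>

lemma positive_op_norm_square_le:
  assumes A: "positive_op A" and M: "0 < M" and le: "\<And>x. quad A x \<le> M * (norm x)\<^sup>2"
  shows "(norm (A x))\<^sup>2 \<le> M * quad A x"
proof -
  have h: "hermitian A"
    using A by (simp add: positive_op_iff)
  define y where "y = M *\<^sub>R x - A x"
  have "0 \<le> quad A y"
    using A by (simp add: positive_op_iff)
  also have "quad A y = M\<^sup>2 * quad A x - 2 * M * (norm (A x))\<^sup>2 + quad A (A x)"
    by (simp add: quad_def y_def blinfun.diff_right blinfun.scaleR_right cinner.diff_left
        cinner.diff_right cinner.scaleR_left cinner.scaleR_right hermitianD[OF h, of x "A x"]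
        cinner_self algebra_simps power2_eq_square)
  also have "\<dots> \<le> M\<^sup>2 * quad A x - 2 * M * (norm (A x))\<^sup>2 + M * (norm (A x))\<^sup>2"
    using le[of "A x"] by simp
  also have "\<dots> = M * (M * quad A x - (norm (A x))\<^sup>2)"
    by (simp add: power2_eq_square algebra_simps)
  finally show ?thesis
    using M by (simp add: zero_le_mult_iff)
qed

lemma positive_op_quad_zero:
  assumes A: "positive_op A" and "quad A x = 0"
  shows "A x = 0"
proof -
  have "quad A y \<le> (norm A + 1) * (norm y)\<^sup>2" for y
    using quad_le_norm[of A y] by (simp add: distrib_right add_increasing2)
  then have "(norm (A x))\<^sup>2 \<le> (norm A + 1) * quad A x"
    by (intro positive_op_norm_square_le[OF A]) (auto simp: add_nonneg_pos)
  then show ?thesis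
    using assms by simp
qed


section \<open>The positive square root\<close>

lemma closed_hermitian: "closed (Collect hermitian)"
proof -
  have "closed {A. \<forall>x y. cinner x (blinfun_apply A y) = cinner (A x) y}"
    by (intro closed_Collect_all closed_Collect_eq continuous_intros
        cinner.continuous_on blinfun.continuous_on)
  then show ?thesis
    by (simp add: hermitian_def[abs_def])
qed

text \<open>
  If \<open>X\<close> solves \<open>2 X = T + X\<^sup>2\<close> then \<open>(1 - X)\<^sup>2 = 1 - T\<close>. Such an \<open>X\<close> is found as the limit of the
  iteration started at 0.
\<close>

primrec sqrt_iter :: "('a::chilbert_space \<Rightarrow>\<^sub>L 'a) \<Rightarrow> nat \<Rightarrow> ('a \<Rightarrow>\<^sub>L 'a)" where
  "sqrt_iter T 0 = 0"
| "sqrt_iter T (Suc n) = (1/2) *\<^sub>R (T + (sqrt_iter T n o\<^sub>L sqrt_iter T n))"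

text \<open>
  The same iteration for the scalar \<open>T = 1\<close>. It dominates the operator iteration for every \<open>T\<close> of
  norm at most 1, and so do its increments; since it is increasing and bounded, the operator
  iteration is absolutely convergent in norm.
\<close>

primrec sqrt_majorant :: "nat \<Rightarrow> real" where
  "sqrt_majorant 0 = 0"
| "sqrt_majorant (Suc n) = (1 + (sqrt_majorant n)\<^sup>2) / 2"

lemma sqrt_majorant_bounds: "0 \<le> sqrt_majorant n \<and> sqrt_majorant n \<le> 1"
  by (induction n) (auto simp: power_le_one)

lemma sqrt_majorant_convergent: "convergent sqrt_majorant"
proof -
  have "sqrt_majorant n \<le> sqrt_majorant (Suc n)" for n
    using zero_le_power2[of "1 - sqrt_majorant n"] by (simp add: power2_eq_square algebra_simps)
  then have "incseq sqrt_majorant"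
    by (rule incseq_SucI)
  then show ?thesis
    using sqrt_majorant_bounds incseq_convergent[of sqrt_majorant 1]
    by (metis convergentI)
qed

text \<open>
  Commutation passes through the iteration and survives in the limit: the square root commutes with
  everything that commutes with the operator, which is the key to its uniqueness. Taking \<open>B\<close> to be an
  iterate also shows that the iterates commute with each other.
\<close>

lemma sqrt_iter_commute:
  assumes "B o\<^sub>L T = T o\<^sub>L B"
  shows "B o\<^sub>L sqrt_iter T n = sqrt_iter T n o\<^sub>L B"
proof (induction n)
  case (Suc n)
  have "B (T x) = T (B x)" and "B (sqrt_iter T n x) = sqrt_iter T n (B x)" for x
    using assms Suc by (metis blinfun_apply_blinfun_compose)+
  then show ?case
    by (intro blinfun_eqI) (simp add: blinfun.bilinear_simps)
qed simp

lemma sqrt_iter_hermitian: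
  assumes "hermitian T"
  shows "hermitian (sqrt_iter T n)"
proof (induction n)
  case 0
  show ?case
    by (simp add: hermitian_def cinner.zero_left cinner.zero_right)
next
  case (Suc n)
  then show ?case
    using assms
    by (simp add: hermitian_def blinfun.bilinear_simps cinner.add_left cinner.add_right
        cinner.scaleR_left cinner.scaleR_right)
qed

lemma sqrt_iter_norm_le:
  assumes "norm T \<le> 1"
  shows "norm (sqrt_iter T n) \<le> sqrt_majorant n"
proof (induction n)
  case (Suc n)
  have "norm (sqrt_iter T n o\<^sub>L sqrt_iter T n) \<le> sqrt_majorant n * sqrt_majorant n"
    using norm_blinfun_compose mult_mono[OF Suc Suc] sqrt_majorant_bounds[of n]
    by (meson norm_ge_zero order_trans)
  then have "norm (T + (sqrt_iter T n o\<^sub>L sqrt_iter T n)) \<le> 1 + (sqrt_majorant n)\<^sup>2"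
    using assms norm_triangle_ineq[of T "sqrt_iter T n o\<^sub>L sqrt_iter T n"]
    by (simp add: power2_eq_square)
  then show ?case
    by simp
qed simp

text \<open>
  For commuting iterates \<open>X\<close> and \<open>Y\<close> one has \<open>Y\<^sup>2 - X\<^sup>2 = (Y - X) (Y + X)\<close>, and the scalar increments
  satisfy the corresponding identity.
\<close>

lemma sqrt_iter_step_le:
  assumes "norm T \<le> 1"
  shows "norm (sqrt_iter T (Suc n) - sqrt_iter T n) \<le> sqrt_majorant (Suc n) - sqrt_majorant n"
proof (induction n)
  case 0
  then show ?case
    using assms by simp
next
  case (Suc n)
  let ?X = "sqrt_iter T n" and ?Y = "sqrt_iter T (Suc n)"
  let ?a = "sqrt_majorant n" and ?b = "sqrt_majorant (Suc n)"
  have "T o\<^sub>L ?X = ?X o\<^sub>L T"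
    by (rule sqrt_iter_commute) simp
  then have "?X o\<^sub>L ?Y = ?Y o\<^sub>L ?X"
    by (metis sqrt_iter_commute)
  then have comm: "?X (?Y x) = ?Y (?X x)" for x
    by (metis blinfun_apply_blinfun_compose)
  have "sqrt_iter T (Suc (Suc n)) - ?Y = (1/2) *\<^sub>R ((?Y - ?X) o\<^sub>L (?Y + ?X))"
  proof -
    have "sqrt_iter T (Suc (Suc n)) - ?Y = (1/2) *\<^sub>R ((?Y o\<^sub>L ?Y) - (?X o\<^sub>L ?X))"
    proof -
      have "sqrt_iter T (Suc (Suc n)) - ?Y
          = (1/2) *\<^sub>R (T + (?Y o\<^sub>L ?Y)) - (1/2) *\<^sub>R (T + (?X o\<^sub>L ?X))"
        by (intro arg_cong2[of _ _ _ _ minus] sqrt_iter.simps(2))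
      then show ?thesis
        by (simp add: scaleR_right_diff_distrib[symmetric] del: sqrt_iter.simps)
    qed
    also have "(?Y o\<^sub>L ?Y) - (?X o\<^sub>L ?X) = (?Y - ?X) o\<^sub>L (?Y + ?X)"
      by (intro blinfun_eqI) (simp add: blinfun.bilinear_simps comm del: sqrt_iter.simps)
    finally show ?thesis .
  qed
  also have "norm \<dots> = norm ((?Y - ?X) o\<^sub>L (?Y + ?X)) / 2"
    by (simp del: sqrt_iter.simps)
  also have "\<dots> \<le> (norm (?Y - ?X) * norm (?Y + ?X)) / 2"
    by (intro divide_right_mono norm_blinfun_compose) simp
  also have "\<dots> \<le> ((?b - ?a) * (?b + ?a)) / 2"
    by (intro divide_right_mono mult_mono' Suc norm_triangle_le add_mono sqrt_iter_norm_le assms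
        norm_ge_zero) simp
  also have "\<dots> = sqrt_majorant (Suc (Suc n)) - ?b"
  proof -
    have "sqrt_majorant (Suc (Suc n)) - ?b = (1 + ?b\<^sup>2) / 2 - (1 + ?a\<^sup>2) / 2"
      by (intro arg_cong2[of _ _ _ _ minus] sqrt_majorant.simps(2))
    then show ?thesis
      by (simp add: power2_eq_square field_simps del: sqrt_majorant.simps)
  qed
  finally show ?case .
qed

lemma sqrt_iter_convergent:
  assumes "norm T \<le> 1"
  shows "convergent (sqrt_iter T)"
proof -
  obtain a where "sqrt_majorant \<longlonglongrightarrow> a"
    using sqrt_majorant_convergent by (auto simp: convergent_def)
  then have "summable (\<lambda>n. sqrt_majorant (Suc n) - sqrt_majorant n)"
    by (rule telescope_summable)
  then have "summable (\<lambda>n. sqrt_iter T (Suc n) - sqrt_iter T n)"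
    by (rule summable_comparison_test'[where N = 0]) (rule sqrt_iter_step_le[OF assms])
  then have "convergent (\<lambda>n. \<Sum>k<n. sqrt_iter T (Suc k) - sqrt_iter T k)"
    by (simp add: summable_iff_convergent)
  then show ?thesis
    by (simp only: sum_lessThan_telescope) simp
qed

lemma sqrt_exists_contraction:
  assumes "hermitian T" and T: "norm T \<le> 1"
  obtains S where "positive_op S" and "S o\<^sub>L S = id_blinfun - T"
    and "\<And>B. B o\<^sub>L T = T o\<^sub>L B \<Longrightarrow> B o\<^sub>L S = S o\<^sub>L B"
proof -
  obtain X where X: "sqrt_iter T \<longlonglongrightarrow> X"
    using sqrt_iter_convergent[OF T] by (auto simp: convergent_def)
  have herm: "hermitian X"
    using closed_sequentially[OF closed_hermitian _ X] sqrt_iter_hermitian[OF assms(1)] by simp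
  have "norm (sqrt_iter T n) \<le> 1" for n
    using sqrt_iter_norm_le[OF T, of n] sqrt_majorant_bounds[of n] by linarith
  then have normX: "norm X \<le> 1"
    by (intro Lim_bounded[OF tendsto_norm[OF X]]) blast
  have "(\<lambda>n. sqrt_iter T (Suc n)) \<longlonglongrightarrow> (1/2) *\<^sub>R (T + (X o\<^sub>L X))"
    unfolding sqrt_iter.simps
    by (intro tendsto_intros bounded_bilinear.tendsto[OF bounded_bilinear_blinfun_compose] X)
  then have fixpoint: "X = (1/2) *\<^sub>R (T + (X o\<^sub>L X))"
    using LIMSEQ_unique X LIMSEQ_Suc by blast
  have "2 *\<^sub>R X = T + (X o\<^sub>L X)"
    by (subst fixpoint) simp
  from arg_cong[OF this, of blinfun_apply]
  have fx: "2 *\<^sub>R X x = T x + X (X x)" for x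
    by (simp add: fun_eq_iff blinfun.bilinear_simps)
  show ?thesis
  proof
    show "positive_op (id_blinfun - X)"
      unfolding positive_op_iff
    proof (intro conjI allI)
      show "hermitian (id_blinfun - X)"
        using herm by (simp add: hermitian_def blinfun.bilinear_simps cinner.diff_left cinner.diff_right)
      fix x
      have "quad X x \<le> (norm x)\<^sup>2"
        using quad_le_norm[of X x] mult_right_mono[OF normX zero_le_power2[of "norm x"]] by simp
      then show "0 \<le> quad (id_blinfun - X) x"
        by (simp add: quad_def blinfun.bilinear_simps cinner.diff_right cinner_self)
    qed
    show "(id_blinfun - X) o\<^sub>L (id_blinfun - X) = id_blinfun - T"
      using fx by (intro blinfun_eqI) (simp add: blinfun.bilinear_simps algebra_simps scaleR_2)
    show "B o\<^sub>L (id_blinfun - X) = (id_blinfun - X) o\<^sub>L B" if "B o\<^sub>L T = T o\<^sub>L B" for B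
    proof -
      have "(\<lambda>n. B o\<^sub>L sqrt_iter T n) \<longlonglongrightarrow> (B o\<^sub>L X)"
        by (intro bounded_bilinear.tendsto[OF bounded_bilinear_blinfun_compose] X tendsto_const)
      moreover have "(\<lambda>n. B o\<^sub>L sqrt_iter T n) \<longlonglongrightarrow> (X o\<^sub>L B)"
        unfolding sqrt_iter_commute[OF that]
        by (intro bounded_bilinear.tendsto[OF bounded_bilinear_blinfun_compose] X tendsto_const)
      ultimately have "B o\<^sub>L X = X o\<^sub>L B"
        by (rule LIMSEQ_unique)
      then have "B (X x) = X (B x)" for x
        by (metis blinfun_apply_blinfun_compose)
      then show ?thesis
        by (intro blinfun_eqI) (simp add: blinfun.bilinear_simps)
    qed
  qed
qed

text \<open>
  Rescaling: with \<open>M\<close> larger than the norm of \<open>A\<close>, the operator \<open>T = 1 - A / M\<close> has norm at most 1, and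
  \<open>A = M (1 - T)\<close>. The norm bound is obtained by expanding \<open>\<parallel>x - A x / M\<parallel>\<^sup>2\<close> and estimating the
  quadratic term by \<open>\<langle>x, A x\<rangle> / M\<close>.
\<close>

lemma sqrt_exists:
  assumes A: "positive_op A"
  obtains S where "positive_op S" and "S o\<^sub>L S = A"
    and "\<And>B. B o\<^sub>L A = A o\<^sub>L B \<Longrightarrow> B o\<^sub>L S = S o\<^sub>L B"
proof -
  \<comment> \<open>The summand 1 keeps \<open>M\<close> positive when \<open>A = 0\<close>.\<close>
  define M where "M = norm A + 1"
  have M: "0 < M"
    by (simp add: M_def add_nonneg_pos)
  have le: "quad A x \<le> M * (norm x)\<^sup>2" for x
    using quad_le_norm[of A x] by (simp add: M_def distrib_right add_increasing2)
  have h: "hermitian A" and pos: "\<And>x. 0 \<le> quad A x"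
    using A by (auto simp: positive_op_iff)
  define T where "T = id_blinfun - (1/M) *\<^sub>R A"
  have hT: "hermitian T"
    using h by (simp add: T_def hermitian_def blinfun.bilinear_simps cinner.diff_left
        cinner.diff_right cinner.scaleR_left cinner.scaleR_right)
  have nT: "norm T \<le> 1"
  proof (rule norm_blinfun_bound)
    fix x
    have "(norm (T x))\<^sup>2 = (norm x)\<^sup>2 - 2 * (quad A x / M) + (norm (A x))\<^sup>2 / M\<^sup>2"
      using M by (simp add: T_def blinfun.bilinear_simps norm_diff_square cinner.scaleR_right
          quad_def power_mult_distrib power_divide)
    also have "\<dots> \<le> (norm x)\<^sup>2 - 2 * (quad A x / M) + M * quad A x / M\<^sup>2"
      using positive_op_norm_square_le[OF A M le, of x] by (simp add: divide_right_mono)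
    also have "\<dots> = (norm x)\<^sup>2 - quad A x / M"
      using M by (simp add: power2_eq_square)
    also have "\<dots> \<le> (norm x)\<^sup>2"
      using M pos by simp
    finally have "norm (T x) \<le> norm x"
      by (rule power2_le_imp_le) simp
    then show "norm (T x) \<le> 1 * norm x"
      by simp
  qed simp
  obtain S where S: "positive_op S" "S o\<^sub>L S = id_blinfun - T"
    and comm: "\<And>B. B o\<^sub>L T = T o\<^sub>L B \<Longrightarrow> B o\<^sub>L S = S o\<^sub>L B"
    using sqrt_exists_contraction[OF hT nT] by blast
  from arg_cong[OF S(2), of blinfun_apply]
  have SS: "S (S x) = (1/M) *\<^sub>R A x" for x
    by (simp add: T_def fun_eq_iff blinfun.bilinear_simps)
  show ?thesis
  proof
    show "positive_op (sqrt M *\<^sub>R S)"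
      using S(1) M unfolding positive_op_iff hermitian_def quad_def
      by (auto simp add: blinfun.scaleR_left cinner.scaleR_left cinner.scaleR_right
          simp del: Re_complex_of_real)
    show "(sqrt M *\<^sub>R S) o\<^sub>L (sqrt M *\<^sub>R S) = A"
      using M by (intro blinfun_eqI) (simp add: blinfun.bilinear_simps SS)
    show "B o\<^sub>L (sqrt M *\<^sub>R S) = (sqrt M *\<^sub>R S) o\<^sub>L B" if "B o\<^sub>L A = A o\<^sub>L B" for B
    proof -
      have "B (A x) = A (B x)" for x
        using that by (metis blinfun_apply_blinfun_compose)
      then have "B o\<^sub>L T = T o\<^sub>L B"
        by (intro blinfun_eqI) (simp add: T_def blinfun.bilinear_simps)
      then have "B (S x) = S (B x)" for x
        using comm by (metis blinfun_apply_blinfun_compose)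
      then show ?thesis
        by (intro blinfun_eqI) (simp add: blinfun.bilinear_simps)
    qed
  qed
qed

text \<open>
  For \<open>y = (B - C) x\<close> commutation gives \<open>(B + C) y = (B\<^sup>2 - C\<^sup>2) x = 0\<close>. Both forms are nonnegative,
  so \<open>B y = C y = 0\<close>, whence \<open>\<langle>y, y\<rangle> = \<langle>x, (B - C) y\<rangle> = 0\<close>.
\<close>

lemma commuting_sqrt_unique:
  assumes B: "positive_op B" and C: "positive_op C"
    and comm: "B o\<^sub>L C = C o\<^sub>L B" and eq: "B o\<^sub>L B = C o\<^sub>L C"
  shows "B = C"
proof (rule blinfun_eqI)
  fix x
  define y where "y = B x - C x"
  have BC: "B (C x) = C (B x)" and BB: "B (B x) = C (C x)"
    using arg_cong[OF comm, of "\<lambda>A. blinfun_apply A x"] arg_cong[OF eq, of "\<lambda>A. blinfun_apply A x"]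
    by simp_all
  have "C y = - B y"
    by (simp add: y_def blinfun.diff_right BC BB)
  then have "quad B y + quad C y = 0"
    by (simp add: quad_def cinner.minus_right)
  moreover have "0 \<le> quad B y" "0 \<le> quad C y"
    using B C by (auto simp: positive_op_iff)
  ultimately have "quad B y = 0" "quad C y = 0"
    by linarith+
  then have "B y = 0" "C y = 0"
    using positive_op_quad_zero B C by blast+
  moreover have "hermitian B" "hermitian C"
    using B C by (auto simp: positive_op_iff)
  ultimately have "cinner (B x) y = 0" "cinner (C x) y = 0"
    by (metis hermitianD cinner.zero_right)+
  then have "cinner y y = 0"
    by (metis y_def cinner.diff_left diff_zero)
  then show "B x = C x"
    by (simp add: cinner_eq_zero_iff y_def)
qed

text \<open>
  Any positive square root \<open>B\<close> of \<open>A\<close> commutes with \<open>A = B\<^sup>2\<close>, hence with the constructed root, so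
  uniqueness for commuting roots applies.
\<close>

lemma ex1_sqrt:
  assumes A: "positive_op A"
  shows "\<exists>!S. positive_op S \<and> S o\<^sub>L S = A"
proof -
  obtain S where S: "positive_op S" "S o\<^sub>L S = A"
    and comm: "\<And>B. B o\<^sub>L A = A o\<^sub>L B \<Longrightarrow> B o\<^sub>L S = S o\<^sub>L B"
    using sqrt_exists[OF A] by blast
  have "B = S" if "positive_op B" "B o\<^sub>L B = A" for B
  proof (rule commuting_sqrt_unique)
    have "B o\<^sub>L A = A o\<^sub>L B"
      by (intro blinfun_eqI) (simp flip: that(2))
    then show "B o\<^sub>L S = S o\<^sub>L B"
      by (rule comm)
  qed (use S that in auto)
  then show ?thesis
    using S by blast
qed

lemma
  assumes "positive_op A"
  shows positive_op_sqrt_op: "positive_op (sqrt_op A)"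
    and sqrt_op_square: "sqrt_op A o\<^sub>L sqrt_op A = A"
  unfolding sqrt_op_def using theI'[OF ex1_sqrt[OF assms]] by blast+

lemma sqrt_op_hermitian: "positive_op A \<Longrightarrow> hermitian (sqrt_op A)"
  using positive_op_sqrt_op[of A] by (simp add: positive_op_iff)

lemma norm_sqrt_op_square: "positive_op A \<Longrightarrow> (norm (sqrt_op A x))\<^sup>2 = quad A x"
  by (metis quad_square sqrt_op_hermitian sqrt_op_square)

lemma abs_op_positive_op:
  assumes "positive_op A"
  shows "abs_op A = A"
proof -
  have h: "hermitian A"
    using assms by (simp add: positive_op_iff)
  have "adj_op A = A"
    unfolding adj_op_def
  proof (rule the_equality)
    show "\<forall>x y. cinner (A x) y = cinner x (A y)"
      using h by (simp add: hermitian_def)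
    show "B = A" if "\<forall>x y. cinner (blinfun_apply B x) y = cinner x (A y)" for B
      using that h by (intro blinfun_eqI cinner_left_ext) (simp add: hermitianD)
  qed
  moreover have "sqrt_op (A o\<^sub>L A) = A"
    unfolding sqrt_op_def
    using the1_equality[OF ex1_sqrt[OF positive_op_square[OF h]]] assms by simp
  ultimately show ?thesis
    by (simp add: abs_op_def)
qed


section \<open>Parseval's identity as an approximation\<close>

text \<open>
  The projection onto the span of \<open>F\<close> is the best approximation, so an arbitrary combination of \<open>F\<close> is
  at least as far from \<open>v\<close>. In the induction one term \<open>c f f\<close> is subtracted from \<open>v\<close>: this lowers
  the squared norm by at most \<open>\<bar>\<langle>f, v\<rangle>\<bar>\<^sup>2\<close> and keeps the other coefficients.
\<close>

lemma norm_square_le_coefficients_plus_dist: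
  fixes v :: "'a::chilbert_space" and c :: "'a \<Rightarrow> complex"
  assumes "finite F" and "\<And>e f. e \<in> F \<Longrightarrow> f \<in> F \<Longrightarrow> cinner e f = (if e = f then 1 else 0)"
  shows "(norm v)\<^sup>2 \<le> (\<Sum>e\<in>F. (cmod (cinner e v))\<^sup>2) + (norm (v - (\<Sum>e\<in>F. c e *\<^sub>C e)))\<^sup>2"
  using assms
proof (induction F arbitrary: v rule: finite_induct)
  case (insert f F)
  define v' where "v' = v - c f *\<^sub>C f"
  have ff: "cinner f f = 1"
    using insert.prems[of f f] by simp
  have "norm f = 1"
    using ff by (simp add: norm_eq_sqrt_cinner)
  then have "(norm v')\<^sup>2 = (norm v)\<^sup>2 - 2 * Re (c f * cinner v f) + (cmod (c f))\<^sup>2"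
    by (simp add: v'_def norm_diff_square cinner_scaleC_right norm_scaleC)
  moreover have "Re (c f * cinner v f) \<le> cmod (c f) * cmod (cinner f v)"
    by (metis complex_Re_le_cmod norm_mult cinner_cnj complex_mod_cnj)
  moreover have "2 * (cmod (c f) * cmod (cinner f v)) \<le> (cmod (c f))\<^sup>2 + (cmod (cinner f v))\<^sup>2"
    using zero_le_power2[of "cmod (c f) - cmod (cinner f v)"]
    by (simp add: power2_eq_square algebra_simps)
  ultimately have v': "(norm v)\<^sup>2 \<le> (norm v')\<^sup>2 + (cmod (cinner f v))\<^sup>2"
    by linarith
  have "cinner e v' = cinner e v" if "e \<in> F" for e
  proof -
    have "cinner e f = 0"
      using insert.prems[of e f] that insert.hyps by auto
    then show ?thesis
      by (simp add: v'_def cinner.diff_right cinner_scaleC_right)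
  qed
  then have "(\<Sum>e\<in>F. (cmod (cinner e v'))\<^sup>2) = (\<Sum>e\<in>F. (cmod (cinner e v))\<^sup>2)"
    by simp
  moreover have "(norm v')\<^sup>2 \<le> (\<Sum>e\<in>F. (cmod (cinner e v'))\<^sup>2) + (norm (v' - (\<Sum>e\<in>F. c e *\<^sub>C e)))\<^sup>2"
    by (rule insert.IH) (simp add: insert.prems)
  moreover have "v' - (\<Sum>e\<in>F. c e *\<^sub>C e) = v - (\<Sum>e\<in>insert f F. c e *\<^sub>C e)"
    using insert.hyps by (simp add: v'_def)
  ultimately show ?case
    using v' insert.hyps by simp
qed simp

lemma onb_finite_coefficients:
  fixes v :: "'a::chilbert_space"
  assumes B: "is_onb B" and "0 < \<epsilon>"
  obtains F where "finite F" and "F \<subseteq> B"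
    and "(norm v)\<^sup>2 \<le> (\<Sum>e\<in>F. (cmod (cinner e v))\<^sup>2) + \<epsilon>"
proof -
  interpret vector_space "scaleC :: complex \<Rightarrow> 'a \<Rightarrow> 'a"
    by (rule vector_space_scaleC)
  have "v \<in> closure (span B)"
    using B by (simp add: is_onb_def)
  then obtain w where "w \<in> span B" and w: "dist w v < sqrt \<epsilon>"
    using assms(2) by (meson closure_approachable real_sqrt_gt_zero)
  then obtain F c where F: "finite F" "F \<subseteq> B" and "w = (\<Sum>e\<in>F. c e *\<^sub>C e)"
    by (auto simp: span_explicit)
  moreover have "(norm v)\<^sup>2 \<le> (\<Sum>e\<in>F. (cmod (cinner e v))\<^sup>2) + (norm (v - (\<Sum>e\<in>F. c e *\<^sub>C e)))\<^sup>2"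
    using B F by (intro norm_square_le_coefficients_plus_dist) (auto simp: is_onb_def subset_iff)
  moreover have "(norm (v - w))\<^sup>2 \<le> \<epsilon>"
    using w assms(2) by (metis dist_commute dist_norm less_eq_real_def norm_ge_zero
        power_mono real_sqrt_pow2)
  ultimately show ?thesis
    using that by fastforce
qed


section \<open>One step of the recursion and the trace\<close>

definition deflate :: "('a::chilbert_space \<Rightarrow>\<^sub>L 'a) \<Rightarrow> 'a \<Rightarrow> ('a \<Rightarrow>\<^sub>L 'a)" where
  "deflate A u = sqrt_op A o\<^sub>L (id_blinfun - ketbra u u) o\<^sub>L sqrt_op A"

lemma deflate_apply:
  "deflate A u x = sqrt_op A (sqrt_op A x - cinner u (sqrt_op A x) *\<^sub>C u)"
  by (simp add: deflate_def blinfun.diff_left ketbra_apply)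

lemma quad_deflate:
  assumes "positive_op A"
  shows "quad (deflate A u) x = quad A x - (cmod (cinner u (sqrt_op A x)))\<^sup>2"
proof -
  let ?y = "sqrt_op A x"
  have "cinner x (deflate A u x) = cinner ?y ?y - cinner u ?y * cnj (cinner u ?y)"
    by (simp add: deflate_apply hermitianD[OF sqrt_op_hermitian[OF assms]] cinner.diff_right
        cinner_scaleC_right cinner_cnj)
  also have "\<dots> = complex_of_real ((norm ?y)\<^sup>2 - (cmod (cinner u ?y))\<^sup>2)"
    by (simp only: cinner_self complex_norm_square of_real_diff)
  finally show ?thesis
    by (simp only: quad_def[of "deflate A u"] Re_complex_of_real norm_sqrt_op_square[OF assms])
qed

lemma positive_op_deflate:
  assumes A: "positive_op A" and "norm u = 1"
  shows "positive_op (deflate A u)"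
  unfolding positive_op_iff
proof (intro conjI allI)
  let ?S = "sqrt_op A"
  have S: "cinner x (?S y) = cinner (?S x) y" for x y
    by (rule hermitianD[OF sqrt_op_hermitian[OF A]])
  have "cinner x (deflate A u y) = cinner (?S x) (?S y) - cinner u (?S y) * cinner (?S x) u" for x y
    by (simp add: deflate_apply S cinner.diff_right cinner_scaleC_right)
  moreover have "cinner (deflate A u x) y = cinner (?S x) (?S y) - cinner (?S x) u * cinner u (?S y)" for x y
    by (simp add: deflate_apply S[symmetric] cinner.diff_left cinner_scaleC_left cinner_cnj)
  ultimately show "hermitian (deflate A u)"
    by (simp add: hermitian_def)
  show "0 \<le> quad (deflate A u) x" for x
  proof -
    have "(cmod (cinner u (?S x)))\<^sup>2 \<le> (norm (?S x))\<^sup>2"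
      using cinner_Cauchy_Schwarz[of u "?S x"] assms(2) by (intro power_mono) auto
    then show ?thesis
      by (simp add: quad_deflate[OF A] norm_sqrt_op_square[OF A])
  qed
qed

text \<open>
  A bound on the trace relative to the basis \<open>B\<close>. Only finite partial sums appear, so that no
  infinite sum has to be manipulated along the recursion.
\<close>

definition trace_le :: "'a::chilbert_space set \<Rightarrow> ('a \<Rightarrow>\<^sub>L 'a) \<Rightarrow> real \<Rightarrow> bool" where
  "trace_le B A C \<longleftrightarrow> (\<forall>F. finite F \<and> F \<subseteq> B \<longrightarrow> (\<Sum>e\<in>F. quad A e) \<le> C)"

text \<open>
  The absolute value in the definition of the trace class disappears because a positive operator is
  its own absolute value.
\<close>

lemma trace_class_positive_trace_le:
  assumes "trace_class A" and A: "positive_op A"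
  obtains B C where "is_onb B" and "trace_le B A C"
proof -
  obtain B where B: "is_onb B" and summ: "(\<lambda>e. cinner e (A e)) summable_on B"
    using assms abs_op_positive_op[OF A] by (auto simp: trace_class_def)
  have "(\<lambda>e. quad A e) summable_on B"
    using summable_on_Re[OF summ] by (simp add: quad_def)
  then have "(\<Sum>e\<in>F. quad A e) \<le> infsum (quad A) B" if "finite F" "F \<subseteq> B" for F
    using that A by (intro finite_sum_le_infsum) (auto simp: positive_op_iff)
  then have "trace_le B A (infsum (quad A) B)"
    by (simp add: trace_le_def)
  then show ?thesis
    using B that by blast
qed

text \<open>
  The form at \<open>e\<close> drops by \<open>\<bar>\<langle>u, S e\<rangle>\<bar>\<^sup>2 = \<bar>\<langle>e, S u\<rangle>\<bar>\<^sup>2\<close>, where \<open>S\<close> is the square root of \<open>A\<close>. A finite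
  part \<open>F'\<close> of the basis captures \<open>\<parallel>S u\<parallel>\<^sup>2 = \<langle>u, A u\<rangle>\<close> up to \<open>\<epsilon>\<close>; enlarging \<open>F\<close> by \<open>F'\<close> only
  increases the sum to be bounded, since the new forms are nonnegative.
\<close>

lemma trace_le_deflate:
  assumes B: "is_onb B" and A: "positive_op A" and u: "norm u = 1" and le: "trace_le B A C"
  shows "trace_le B (deflate A u) (C - quad A u)"
  unfolding trace_le_def
proof (intro allI impI, elim conjE)
  fix F
  assume F: "finite F" "F \<subseteq> B"
  let ?S = "sqrt_op A"
  show "(\<Sum>e\<in>F. quad (deflate A u) e) \<le> C - quad A u"
  proof (rule field_le_epsilon)
    fix \<epsilon> :: real
    assume "0 < \<epsilon>"
    then obtain F' where F': "finite F'" "F' \<subseteq> B"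
      and u': "(norm (?S u))\<^sup>2 \<le> (\<Sum>e\<in>F'. (cmod (cinner e (?S u)))\<^sup>2) + \<epsilon>"
      using onb_finite_coefficients[OF B] by blast
    let ?G = "F \<union> F'"
    have "(\<Sum>e\<in>F. quad (deflate A u) e) \<le> (\<Sum>e\<in>?G. quad (deflate A u) e)"
      using positive_op_deflate[OF A u] F F' by (intro sum_mono2) (auto simp: positive_op_iff)
    also have "\<dots> = (\<Sum>e\<in>?G. quad A e) - (\<Sum>e\<in>?G. (cmod (cinner u (?S e)))\<^sup>2)"
      by (simp add: quad_deflate[OF A] sum_subtractf)
    finally have "(\<Sum>e\<in>F. quad (deflate A u) e)
        \<le> (\<Sum>e\<in>?G. quad A e) - (\<Sum>e\<in>?G. (cmod (cinner u (?S e)))\<^sup>2)" .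
    moreover have "(\<Sum>e\<in>?G. quad A e) \<le> C"
      using le F F' by (simp add: trace_le_def)
    moreover have "(\<Sum>e\<in>F'. (cmod (cinner e (?S u)))\<^sup>2) \<le> (\<Sum>e\<in>?G. (cmod (cinner e (?S u)))\<^sup>2)"
      using F F' by (intro sum_mono2) auto
    moreover have "cmod (cinner e (?S u)) = cmod (cinner u (?S e))" for e
      by (metis hermitianD[OF sqrt_op_hermitian[OF A]] cinner_cnj complex_mod_cnj)
    ultimately show "(\<Sum>e\<in>F. quad (deflate A u) e) \<le> C - quad A u + \<epsilon>"
      using u' by (simp add: norm_sqrt_op_square[OF A])
  qed
qed


section \<open>Summability of the removed traces\<close>

lemma R_seq_Suc: "R_seq R0 u (Suc n) = deflate (R_seq R0 u n) (u n)"
  by (simp add: deflate_def)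

lemma positive_op_R_seq:
  assumes "positive_op R0" and "\<forall>n. norm (u n) = 1"
  shows "positive_op (R_seq R0 u n)"
proof (induction n)
  case (Suc n)
  then show ?case
    unfolding R_seq_Suc using assms(2) by (intro positive_op_deflate) auto
qed (simp add: assms)

lemma decseq_quad_R_seq:
  assumes "positive_op R0" and "\<forall>n. norm (u n) = 1"
  shows "decseq (\<lambda>n. quad (R_seq R0 u n) x)"
proof (rule decseq_SucI)
  show "quad (R_seq R0 u (Suc n)) x \<le> quad (R_seq R0 u n) x" for n
    using quad_deflate[OF positive_op_R_seq[OF assms], of n "u n" x]
    by (simp add: R_seq_Suc del: R_seq.simps)
qed

text \<open>
  The summand 1 makes the constant positive even for \<open>R0 = 0\<close>, as \<open>positive_op_norm_square_le\<close> and the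
  choice of \<open>\<delta>\<close> in \<open>quad_R_seq_tendsto_zero\<close> require.
\<close>

lemma quad_R_seq_le:
  assumes R0: "positive_op R0" and u: "\<forall>n. norm (u n) = 1"
  shows "quad (R_seq R0 u n) y \<le> (norm R0 + 1) * (norm y)\<^sup>2"
proof -
  have "quad (R_seq R0 u n) y \<le> quad (R_seq R0 u 0) y"
    by (rule decseqD[OF decseq_quad_R_seq[OF R0 u]]) simp
  also have "\<dots> \<le> norm R0 * (norm y)\<^sup>2"
    by (simp add: quad_le_norm)
  also have "\<dots> \<le> (norm R0 + 1) * (norm y)\<^sup>2"
    by (simp add: mult_right_mono)
  finally show ?thesis .
qed

text \<open>
  After \<open>n\<close> steps the trace is at most \<open>C\<close> minus the amounts removed so far. The empty sum is one of
  the sums bounded by \<open>trace_le\<close>, so the total amount removed never exceeds \<open>C\<close>.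
\<close>

lemma summable_quad_R_seq:
  assumes R0: "positive_op R0" "trace_class R0" and u: "\<forall>n. norm (u n) = 1"
  shows "summable (\<lambda>n. quad (R_seq R0 u n) (u n))"
proof -
  note pos = positive_op_R_seq[OF R0(1) u]
  obtain B C where B: "is_onb B" and C: "trace_le B R0 C"
    using trace_class_positive_trace_le R0 by blast
  have le: "trace_le B (R_seq R0 u n) (C - (\<Sum>k<n. quad (R_seq R0 u k) (u k)))" for n
  proof (induction n)
    case (Suc n)
    then show ?case
      using trace_le_deflate[OF B pos _ Suc] u by (simp add: R_seq_Suc diff_diff_eq del: R_seq.simps)
  qed (simp add: C)
  show ?thesis
  proof (rule summableI_nonneg_bounded)
    show "0 \<le> quad (R_seq R0 u n) (u n)" for n
      using pos by (simp add: positive_op_iff)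
    show "(\<Sum>k<n. quad (R_seq R0 u k) (u k)) \<le> C" for n
      using le[of n] by (auto simp: trace_le_def dest: spec[of _ "{}"])
  qed
qed


section \<open>Returns of a dense sequence\<close>

text \<open>
  A point of \<open>Z\<close> that is not in the closure of the tail \<open>u ` {N..}\<close> must be one of the finitely
  many values \<open>u 0, \<dots>, u (N - 1)\<close>; an infinite \<open>Z\<close> has further points.
\<close>

lemma dense_sequence_returns:
  fixes u :: "nat \<Rightarrow> 'a::metric_space"
  assumes "infinite Z" and "Z \<subseteq> closure (range u)" and "0 < \<delta>"
  shows "\<exists>n\<ge>N. \<exists>z\<in>Z. dist (u n) z < \<delta>"
proof (rule ccontr)
  assume far: "\<not> ?thesis"
  have "Z \<subseteq> u ` {..<N}"
  proof
    fix z
    assume z: "z \<in> Z"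
    have "{..<N} \<union> {N..} = UNIV"
      by auto
    then have "range u = u ` {..<N} \<union> u ` {N..}"
      by (metis image_Un)
    moreover have "closure (u ` {..<N}) = u ` {..<N}"
      by (simp add: finite_imp_closed)
    ultimately have "z \<in> u ` {..<N} \<or> z \<in> closure (u ` {N..})"
      using z assms(2) by (simp add: closure_Un subset_iff)
    moreover have "z \<notin> closure (u ` {N..})"
    proof
      assume "z \<in> closure (u ` {N..})"
      then obtain n where "N \<le> n" "dist (u n) z < \<delta>"
        using assms(3) by (auto simp: closure_approachable)
      then show False
        using far z by blast
    qed
    ultimately show "z \<in> u ` {..<N}"
      by blast
  qed
  then show False
    using assms(1) finite_subset by blast
qed

text \<open>
  These are the points to which \<open>dense_sequence_returns\<close> is applied: all of them have the same
  quadratic form, so closeness to any of them is as good as closeness to \<open>x\<close>.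
\<close>

lemma infinite_unit_multiples:
  fixes x :: "'a::chilbert_space"
  assumes "x \<noteq> 0"
  shows "infinite ((\<lambda>w. w *\<^sub>C x) ` sphere 0 1)"
proof -
  have "inj_on (\<lambda>t. Complex t (sqrt (1 - t\<^sup>2))) {0..1}"
    by (rule inj_onI) simp
  moreover have "(\<lambda>t. Complex t (sqrt (1 - t\<^sup>2))) ` {0..1} \<subseteq> sphere 0 1"
    by (auto simp: complex_norm power_le_one)
  moreover have "infinite {0..1::real}"
    by simp
  ultimately have "infinite (sphere (0::complex) 1)"
    by (metis finite_imageD finite_subset)
  moreover have "inj_on (\<lambda>w. w *\<^sub>C x) (sphere 0 1)"
  proof (rule inj_onI)
    interpret vector_space "scaleC :: complex \<Rightarrow> 'a \<Rightarrow> 'a"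
      by (rule vector_space_scaleC)
    show "w = w'" if "w *\<^sub>C x = w' *\<^sub>C x" for w w'
      using that assms by simp
  qed
  ultimately show ?thesis
    using finite_imageD by blast
qed


section \<open>Convergence of the sequence to zero\<close>

lemma quad_R_seq_tendsto_zero:
  assumes R0: "positive_op R0" "trace_class R0" and u: "\<forall>n. norm (u n) = 1"
    and dense: "sphere 0 1 \<subseteq> closure (range u)" and x: "norm x = 1"
  shows "(\<lambda>n. quad (R_seq R0 u n) x) \<longlonglongrightarrow> 0"
proof (rule ccontr)
  let ?R = "R_seq R0 u"
  note pos = positive_op_R_seq[OF R0(1) u]
  have nonneg: "0 \<le> quad (?R n) y" for n y
    using pos by (simp add: positive_op_iff)
  have dec: "quad (?R n) y \<le> quad (?R m) y" if "m \<le> n" for m n y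
    using decseq_quad_R_seq[OF R0(1) u] that by (simp add: decseq_def)
  assume "\<not> ?thesis"
  then obtain \<epsilon> where \<epsilon>: "0 < \<epsilon>" and "\<forall>m. \<exists>n\<ge>m. \<epsilon> \<le> quad (?R n) x"
    using nonneg by (auto simp: LIMSEQ_iff not_less)
  then have below: "\<epsilon> \<le> quad (?R m) x" for m
    using dec order_trans by blast
  define M where "M = norm R0 + 1"
  have M: "0 < M"
    by (simp add: M_def add_nonneg_pos)
  have le: "quad (?R n) y \<le> M * (norm y)\<^sup>2" for n y
    unfolding M_def by (rule quad_R_seq_le[OF R0(1) u])
  \<comment> \<open>Moving by \<open>\<delta>\<close> changes \<open>\<parallel>(R n)\<^bsup>1/2\<^esup> y\<parallel>\<close> by at most \<open>sqrt \<epsilon> / 2\<close>, uniformly in \<open>n\<close>.\<close>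
  define \<delta> where "\<delta> = sqrt \<epsilon> / (2 * sqrt M)"
  have \<delta>: "0 < \<delta>"
    using \<epsilon> M by (simp add: \<delta>_def)
  have far: "\<exists>n\<ge>N. \<epsilon> / 4 \<le> quad (?R n) (u n)" for N
  proof -
    have "(\<lambda>w. w *\<^sub>C x) ` sphere 0 1 \<subseteq> closure (range u)"
      using dense x by (auto simp: norm_scaleC)
    moreover have "x \<noteq> 0"
      using x by auto
    ultimately obtain n w where n: "N \<le> n" and w: "cmod w = 1" and d: "dist (u n) (w *\<^sub>C x) < \<delta>"
      using dense_sequence_returns[of "(\<lambda>w. w *\<^sub>C x) ` sphere 0 1" u \<delta> N]
        infinite_unit_multiples[of x] \<delta> by auto
    let ?S = "sqrt_op (?R n)"
    have S: "norm (?S y) = sqrt (quad (?R n) y)" for y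
      by (simp flip: norm_sqrt_op_square[OF pos])
    have "quad (?R n) (w *\<^sub>C x) = quad (?R n) x"
      using pos w by (simp add: quad_scaleC positive_op_def)
    then have "sqrt \<epsilon> \<le> norm (?S (w *\<^sub>C x))"
      using below by (simp add: S)
    also have "\<dots> \<le> norm (?S (u n)) + norm (?S (u n - w *\<^sub>C x))"
      using norm_triangle_sub[of "?S (w *\<^sub>C x)" "?S (u n)"]
      by (simp add: blinfun.diff_right norm_minus_commute)
    also have "norm (?S (u n - w *\<^sub>C x)) \<le> sqrt M * norm (u n - w *\<^sub>C x)"
      using real_sqrt_le_mono[OF le[of n "u n - w *\<^sub>C x"]] by (simp add: S real_sqrt_mult)
    also have "\<dots> \<le> sqrt M * \<delta>"
      using d M by (intro mult_left_mono) (auto simp: dist_norm)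
    also have "\<dots> = sqrt \<epsilon> / 2"
      using M by (simp add: \<delta>_def)
    finally have "sqrt \<epsilon> / 2 \<le> sqrt (quad (?R n) (u n))"
      by (simp add: S)
    then have "\<epsilon> / 4 \<le> quad (?R n) (u n)"
      by (metis real_sqrt_divide real_sqrt_four real_sqrt_le_iff)
    then show ?thesis
      using n by blast
  qed
  have "(\<lambda>n. quad (?R n) (u n)) \<longlonglongrightarrow> 0"
    by (rule summable_LIMSEQ_zero[OF summable_quad_R_seq[OF R0 u]])
  then obtain N where "\<forall>n\<ge>N. quad (?R n) (u n) < \<epsilon> / 4"
    using \<epsilon> order_tendstoD(2)[of "\<lambda>n. quad (?R n) (u n)" 0 sequentially "\<epsilon> / 4"]
    by (auto simp: eventually_sequentially)
  then show False
    using far[of N] by force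
qed

lemma R_seq_tendsto_zero:
  assumes R0: "positive_op R0" "trace_class R0" and u: "\<forall>n. norm (u n) = 1"
    and dense: "sphere 0 1 \<subseteq> closure (range u)"
  shows "(\<lambda>n. R_seq R0 u n x) \<longlonglongrightarrow> 0"
proof -
  let ?R = "R_seq R0 u"
  note pos = positive_op_R_seq[OF R0(1) u]
  have quad0: "(\<lambda>n. quad (?R n) x) \<longlonglongrightarrow> 0"
  proof (cases "x = 0")
    case True
    then show ?thesis
      by (simp add: quad_def cinner.zero_left)
  next
    case False
    define y where "y = (1 / norm x) *\<^sub>R x"
    have "norm y = 1"
      using False by (simp add: y_def)
    have "quad (?R n) x = (norm x)\<^sup>2 * quad (?R n) y" for n
    proof -
      have "x = complex_of_real (norm x) *\<^sub>C y"
        using False by (simp add: y_def flip: scaleR_scaleC)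
      then show ?thesis
        using quad_scaleC[of "?R n" "complex_of_real (norm x)" y] pos[of n]
        by (simp add: positive_op_def)
    qed
    moreover have "(\<lambda>n. (norm x)\<^sup>2 * quad (?R n) y) \<longlonglongrightarrow> (norm x)\<^sup>2 * 0"
      by (intro tendsto_intros quad_R_seq_tendsto_zero[OF R0 u dense \<open>norm y = 1\<close>])
    ultimately show ?thesis
      by simp
  qed
  define M where "M = norm R0 + 1"
  have M: "0 < M"
    by (simp add: M_def add_nonneg_pos)
  have le: "quad (?R n) y \<le> M * (norm y)\<^sup>2" for n y
    unfolding M_def by (rule quad_R_seq_le[OF R0(1) u])
  have bound: "(norm (?R n x))\<^sup>2 \<le> M * quad (?R n) x" for n
    by (rule positive_op_norm_square_le[OF pos M le])
  have "(\<lambda>n. M * quad (?R n) x) \<longlonglongrightarrow> 0"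
    using tendsto_mult_left[OF quad0, of M] by simp
  then have "(\<lambda>n. (norm (?R n x))\<^sup>2) \<longlonglongrightarrow> 0"
    by (rule Lim_null_comparison[rotated]) (simp add: bound)
  then have "(\<lambda>n. norm (?R n x)) \<longlonglongrightarrow> 0"
    using tendsto_real_sqrt[of "\<lambda>n. (norm (?R n x))\<^sup>2" 0] by simp
  then show ?thesis
    by (rule tendsto_norm_zero_cancel)
qed


section \<open>Strong operator convergence\<close>

lemma limitin_strong_operator_topology_iff:
  fixes T :: "'c \<Rightarrow> ('a::real_normed_vector \<Rightarrow>\<^sub>L 'b::real_normed_vector)"
  shows "limitin strong_operator_topology T A F \<longleftrightarrow> (\<forall>x. ((\<lambda>n. blinfun_apply (T n) x) \<longlongrightarrow> A x) F)"
proof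
  assume "limitin strong_operator_topology T A F"
  then show "\<forall>x. ((\<lambda>n. blinfun_apply (T n) x) \<longlongrightarrow> A x) F"
    using continuous_map_limit[OF strong_operator_topology_continuous_evaluation]
    by (fastforce simp: o_def)
next
  assume *: "\<forall>x. ((\<lambda>n. blinfun_apply (T n) x) \<longlongrightarrow> A x) F"
  have "limitin (product_topology (\<lambda>_. euclidean) UNIV) (\<lambda>n. blinfun_apply (T n)) (blinfun_apply A) F"
    using * by (simp add: limitin_componentwise)
  then have lim: "limitin euclidean (\<lambda>n. blinfun_apply (T n)) (blinfun_apply A) F"
    by (simp only: euclidean_product_topology)
  show "limitin strong_operator_topology T A F"
    unfolding limitin_def strong_operator_topology_def openin_pullback_topology
  proof (intro conjI allI impI)
    show "A \<in> topspace (pullback_topology UNIV blinfun_apply euclidean)"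
      by (simp add: topspace_pullback_topology)
    show "\<forall>\<^sub>F n in F. T n \<in> U"
      if "(\<exists>V. openin euclidean V \<and> U = blinfun_apply -` V \<inter> UNIV) \<and> A \<in> U" for U
      using lim that by (fastforce simp: limitin_def)
  qed
qed

theorem proposition3p8:
  fixes R0 :: "'a::chilbert_space \<Rightarrow>\<^sub>L 'a"
    and u :: "nat \<Rightarrow> 'a"
  assumes "trace_class R0"
    and "positive_op R0"
    and "\<forall>n. norm (u n) = 1"
    and "sphere 0 1 \<subseteq> closure (range u)"
  shows "limitin strong_operator_topology (R_seq R0 u) (R_infty R0 u) sequentially
    \<and> R_infty R0 u = 0"
proof -
  have lim: "limitin strong_operator_topology (R_seq R0 u) 0 sequentially"
    using R_seq_tendsto_zero[of R0 u] assms by (simp add: limitin_strong_operator_topology_iff)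
  have "T = 0" if "limitin strong_operator_topology (R_seq R0 u) T sequentially" for T
    using lim that LIMSEQ_unique
    by (intro blinfun_eqI) (fastforce simp: limitin_strong_operator_topology_iff)
  then have "R_infty R0 u = 0"
    unfolding R_infty_def using lim by (intro the_equality) auto
  then show ?thesis
    using lim by simp
qed

end
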